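(* As an identity of formal power series in $q$ (equivalently, for $|q|<1$), \[ \sum_{n\geq 0} F_1(n) q^n = q\,\frac{(q^{16},-q^2,-q^{14};q^{16})_\infty}{(q;q^2)_\infty (q^2;q^2)_\infty^2}. \]
   Context: Notation: $(a;q)_\infty=\prod_{j=0}^\infty(1-aq^j)$ and $(a_1,\ldots,a_k;q)_\infty=\prod_{j=1}^k (a_j;q)_\infty$. A two-color partition of $n$ is a finite multiset of positive integers (parts), each part colored red or blue, whose sum is $n$ (the same integer in two different colors counts as two different kinds of parts). For a nonnegative integer $n$, $\mathcal{F}(n)$ is the set of two-color partitions of $n$ in which even parts may occur only in blue color (odd parts may occur in either color; repetitions are allowed). $F_1(n)$ is the number of partitions in $\mathcal{F}(n)$ in which the number of red odd parts (counted with multiplicity) is odd. *)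

theory Defs
  imports "HOL-Library.Multiset" "HOL-Analysis.Infinite_Products"
    "HOL-Computational_Algebra.Formal_Power_Series"
begin

datatype color = Red | Blue

text \<open>A part is a pair (size, color), so the same integer in two colors gives two distinct parts.\<close>

definition two_color_partitions :: "nat \<Rightarrow> (nat \<times> color) multiset set" where
  "two_color_partitions n =
     {P. (\<forall>p\<in>#P. 0 < fst p) \<and> (\<Sum>p\<in>#P. fst p) = n}"

definition \<F> :: "nat \<Rightarrow> (nat \<times> color) multiset set" where
  "\<F> n = {P \<in> two_color_partitions n. \<forall>p\<in>#P. even (fst p) \<longrightarrow> snd p = Blue}"

definition F1 :: "nat \<Rightarrow> nat" where
  "F1 n = card {P \<in> \<F> n. odd (size {#p \<in># P. snd p = Red \<and> odd (fst p)#})}"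

lemma finite_\<F>: "finite (\<F> n)"
proof (rule finite_subset)
  let ?A = "{..n} \<times> {Red, Blue}"
  show "\<F> n \<subseteq> (\<Union>k\<le>n. {P. set_mset P \<subseteq> ?A \<and> size P = k})"
  proof
    fix P assume "P \<in> \<F> n"
    hence pos: "\<forall>p\<in>#P. 0 < fst p" and sum: "(\<Sum>p\<in>#P. fst p) = n"
      by (auto simp: \<F>_def two_color_partitions_def)
    have "fst p \<le> n" if "p \<in># P" for p
      using sum multi_member_split[OF that] by auto
    moreover have "size P \<le> n"
    proof -
      have "size P = (\<Sum>p\<in>#P. 1)"
        by simp
      also have "\<dots> \<le> (\<Sum>p\<in>#P. fst p)"
        using pos by (intro sum_mset_mono) auto
      finally show ?thesis using sum by simp
    qed
    moreover have "snd p \<in> {Red, Blue}" for p :: "nat \<times> color"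
      by (cases "snd p") simp_all
    ultimately show "P \<in> (\<Union>k\<le>n. {P. set_mset P \<subseteq> ?A \<and> size P = k})"
      by (fastforce simp: mem_Times_iff)
  qed
  show "finite (\<Union>k\<le>n. {P. set_mset P \<subseteq> ?A \<and> size P = k})"
    using finite_multisets_of_size[of ?A] by (simp add: multisets_of_size_def)
qed

text \<open>For formal power series, the infinite product below is a limit in the \<open>q\<close>-adic metric.\<close>

definition qpoch :: "'a \<Rightarrow> 'a \<Rightarrow> 'a :: {t2_space, comm_ring_1}" where
  "qpoch a q = (\<Prod>j. 1 - a * q ^ j)"

definition qpochs :: "'a list \<Rightarrow> 'a \<Rightarrow> 'a :: {t2_space, comm_ring_1}" where
  "qpochs as q = (\<Prod>a\<leftarrow>as. qpoch a q)"

lemma has_prod_qpoch_fps: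
  fixes a q :: "'a :: {idom, t2_space} fps"
  assumes "a \<noteq> 0" "q \<noteq> 0" "fps_nth a 0 = 0" "fps_nth q 0 = 0"
  shows "(\<lambda>j. 1 - a * q ^ j) has_prod qpoch a q"
proof -
  define f where "f j = 1 - a * q ^ j" for j
  have f0: "fps_nth (f j) 0 = 1" for j
    using assms by (simp add: f_def)
  have nz: "f j \<noteq> 0" for j
  proof
    assume "f j = 0"
    with f0[of j] show False by simp
  qed
  have pos: "subdegree a > 0" "subdegree q > 0"
    using assms by (simp_all add: subdegree_eq_0_iff zero_less_iff_neq_zero)
  have "subdegree (f k - 1) > n" if "k > n" for n k
  proof -
    have "subdegree (f k - 1) = subdegree a + k * subdegree q"
      using assms by (simp add: f_def subdegree_power)
    also have "\<dots> \<ge> k * 1"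
      using pos by (intro trans_le_add2 mult_le_mono) auto
    finally show ?thesis using that by simp
  qed
  from tendsto_prod_fps[of f "\<lambda>n. n", OF nz this]
  obtain L where L: "(\<lambda>n. \<Prod>k\<le>n. f k) \<longlonglongrightarrow> L" by blast
  have "fps_nth (\<Prod>k\<le>n. f k) 0 = 1" for n
    by (induction n) (simp_all add: f0)
  moreover have "eventually (\<lambda>n. fps_nth (\<Prod>k\<le>n. f k) 0 = fps_nth L 0) sequentially"
    using L unfolding tendsto_fps_iff by blast
  ultimately have "fps_nth L 0 = 1"
    by (auto simp: eventually_sequentially)
  hence "L \<noteq> 0" by auto
  with L have "f has_prod L"
    by (simp add: has_prod_def raw_has_prod_def)
  hence "f has_prod (prodinf f)"
    using has_prod_unique by blast
  thus ?thesis by (simp add: f_def[abs_def] qpoch_def)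
qed

end

theory Submission
  imports Defs "HOL-Analysis.Infinite_Sum"
begin

text \<open>
  Write $P = (q;q^2)_\infty$, $M = (-q;q^2)_\infty$ and $E = (q^2;q^2)_\infty$. Counting the
  partitions in \<open>\<F> n\<close> with weight \<open>e\<close> for every red odd part gives the generating function
  $1/((eq;q^2)_\infty\, P\, E)$ (\<open>generating_function_\<F>\<close>), and half the difference of its values
  at $e = 1$ and $e = -1$ retains exactly the partitions with an odd number of red odd parts. Hence
  \[ 2\sum_n F_1(n) q^n = \frac{1}{P E}\left(\frac 1P - \frac 1M\right)
     = \frac{1}{P E^2}\left(\frac EP - \frac EM\right). \]
  By a theorem of Gauss (\<open>gauss_triangular_fps\<close>), $E/P = \sum_{k\in\mathbb{Z}} q^{k(2k-1)}$, and
  $E/M$ is the same series with $q$ replaced by $-q$. The exponent $k(2k-1)$ has the parity of $k$,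
  so in the difference only the odd $k = 2m+1$ survive, each of them twice:
  \[ \frac EP - \frac EM = 2q \sum_{m\in\mathbb{Z}} q^{8m^2+6m}. \]
  The Jacobi triple product (\<open>jacobi_triple_product_fps\<close>) with $a = q^{14}$ and $b = q^2$ turns the
  sum on the right into $(q^{16},-q^2,-q^{14};q^{16})_\infty$ (\<open>odd_part_of_gauss_series\<close>).

  Gauss's theorem is also a case of the triple product, with $a = q$ and $b = q^3$. The triple
  product itself is the limit of a finite identity, which follows from the two Pascal
  recurrences of the $q$-binomial coefficients.
\<close>

section \<open>Limits and sums of formal power series\<close>

lemma fps_cutoff_mult_cong:
  fixes f g :: "'a :: semiring_1 fps"
  assumes "fps_cutoff n f = fps_cutoff n f'" "fps_cutoff n g = fps_cutoff n g'"
  shows "fps_cutoff n (f * g) = fps_cutoff n (f' * g')"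
  using assms unfolding fps_cutoff_eq_fps_cutoff_iff
  by (auto simp: fps_mult_nth intro!: sum.cong)

lemma tendsto_mult_fps:
  fixes f g :: "'b \<Rightarrow> 'a :: ring_1 fps"
  assumes "(f \<longlongrightarrow> a) F" "(g \<longlongrightarrow> b) F"
  shows "((\<lambda>x. f x * g x) \<longlongrightarrow> a * b) F"
proof (rule tendsto_fpsI)
  fix n
  have "\<forall>\<^sub>F x in F. \<forall>k\<in>{..n}. fps_nth (f x) k = fps_nth a k"
       "\<forall>\<^sub>F x in F. \<forall>k\<in>{..n}. fps_nth (g x) k = fps_nth b k"
    using assms by (simp_all add: tendsto_fps_iff eventually_ball_finite)
  thus "\<forall>\<^sub>F x in F. fps_nth (f x * g x) n = fps_nth (a * b) n"
    by eventually_elim (auto simp: fps_mult_nth intro!: sum.cong)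
qed

lemma has_sum_unique_fps:
  fixes f :: "'b \<Rightarrow> 'a :: ab_group_add fps"
  assumes "(f has_sum a) A" "(f has_sum b) A"
  shows "a = b"
  using assms tendsto_unique[OF finite_subsets_at_top_neq_bot] unfolding has_sum_def by blast

lemma has_sum_diff_fps:
  fixes f g :: "'b \<Rightarrow> 'a :: ab_group_add fps"
  assumes "(f has_sum a) A" "(g has_sum b) A"
  shows "((\<lambda>x. f x - g x) has_sum (a - b)) A"
  unfolding has_sum_def
proof (rule tendsto_fpsI)
  fix n
  have "\<forall>\<^sub>F X in finite_subsets_at_top A. fps_nth (sum f X) n = fps_nth a n"
       "\<forall>\<^sub>F X in finite_subsets_at_top A. fps_nth (sum g X) n = fps_nth b n"
    using assms by (simp_all add: has_sum_def tendsto_fps_iff)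
  thus "\<forall>\<^sub>F X in finite_subsets_at_top A. fps_nth (\<Sum>x\<in>X. f x - g x) n = fps_nth (a - b) n"
    by eventually_elim (simp add: sum_subtractf)
qed

lemma has_sum_cmult_right_fps:
  fixes f :: "'b \<Rightarrow> 'a :: ring_1 fps"
  assumes "(f has_sum a) A"
  shows "((\<lambda>x. c * f x) has_sum (c * a)) A"
  using tendsto_mult_fps[OF tendsto_const assms[unfolded has_sum_def], of c]
  by (simp add: has_sum_def sum_distrib_left)

lemma fps_divide_times_unit:
  fixes f g :: "'a :: field fps"
  assumes "fps_nth g 0 \<noteq> 0"
  shows "f / g * g = f"
  using assms by (simp add: fps_divide_unit mult.assoc inverse_mult_eq_1)

section \<open>Infinite $q$-Pochhammer symbols\<close>

lemma tendsto_qpoch_fps: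
  fixes a q :: "'a :: {idom, t2_space} fps"
  assumes "a \<noteq> 0" "q \<noteq> 0" "fps_nth a 0 = 0" "fps_nth q 0 = 0"
  shows "(\<lambda>n. \<Prod>j<n. 1 - a * q ^ j) \<longlonglongrightarrow> qpoch a q"
  by (rule has_prod_imp_tendsto'[OF has_prod_qpoch_fps[OF assms]])

lemma qpoch_fps_nth_0:
  fixes a q :: "'a :: {idom, t2_space} fps"
  assumes "a \<noteq> 0" "q \<noteq> 0" "fps_nth a 0 = 0" "fps_nth q 0 = 0"
  shows "fps_nth (qpoch a q) 0 = 1"
proof -
  have "\<forall>\<^sub>F n in sequentially. fps_nth (\<Prod>j<n. 1 - a * q ^ j) 0 = fps_nth (qpoch a q) 0"
    using tendsto_qpoch_fps[OF assms] unfolding tendsto_fps_iff by blast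
  moreover have "fps_nth (\<Prod>j<n. 1 - a * q ^ j) 0 = 1" for n
    using assms(3) by (induction n) auto
  ultimately show ?thesis by simp
qed

lemma qpoch_fps_nonzero:
  fixes a q :: "'a :: {idom, t2_space} fps"
  assumes "a \<noteq> 0" "q \<noteq> 0" "fps_nth a 0 = 0" "fps_nth q 0 = 0"
  shows "qpoch a q \<noteq> 0"
  using qpoch_fps_nth_0[OF assms] by force

text \<open>The even and the odd powers of \<open>q\<close> in the product, separated.\<close>

lemma qpoch_dissect_fps:
  fixes a q :: "'a :: {idom, t2_space} fps"
  assumes "a \<noteq> 0" "q \<noteq> 0" "fps_nth a 0 = 0" "fps_nth q 0 = 0"
  shows "qpoch a (q ^ 2) * qpoch (a * q) (q ^ 2) = qpoch a q"
proof (rule LIMSEQ_unique)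
  let ?P = "\<lambda>n. (\<Prod>j<n. 1 - a * (q ^ 2) ^ j) * (\<Prod>j<n. 1 - (a * q) * (q ^ 2) ^ j)"
  show "?P \<longlonglongrightarrow> qpoch a (q ^ 2) * qpoch (a * q) (q ^ 2)"
    using assms by (intro tendsto_mult_fps tendsto_qpoch_fps) auto
  have "?P n = (\<Prod>j<2*n. 1 - a * q ^ j)" for n
    by (induction n) (simp_all add: power_mult [symmetric] mult_ac)
  moreover have "(\<lambda>n. \<Prod>j<2*n. 1 - a * q ^ j) \<longlonglongrightarrow> qpoch a q"
    by (rule filterlim_compose[OF tendsto_qpoch_fps[OF assms]])
       (simp add: filterlim_subseq strict_mono_def)
  ultimately show "?P \<longlonglongrightarrow> qpoch a q" by simp
qed

lemma qpoch_times_qpoch_uminus_fps: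
  fixes a q :: "'a :: {idom, t2_space} fps"
  assumes "a \<noteq> 0" "q \<noteq> 0" "fps_nth a 0 = 0" "fps_nth q 0 = 0"
  shows "qpoch a q * qpoch (-a) q = qpoch (a ^ 2) (q ^ 2)"
proof (rule LIMSEQ_unique)
  let ?P = "\<lambda>n. (\<Prod>j<n. 1 - a * q ^ j) * (\<Prod>j<n. 1 - (-a) * q ^ j)"
  show "?P \<longlonglongrightarrow> qpoch a q * qpoch (-a) q"
    using assms by (intro tendsto_mult_fps tendsto_qpoch_fps) auto
  have "?P n = (\<Prod>j<n. 1 - a ^ 2 * (q ^ 2) ^ j)" for n
    unfolding prod.distrib [symmetric]
    by (intro prod.cong refl) (simp add: algebra_simps power2_eq_square power_mult_distrib)
  moreover have "(\<lambda>n. \<Prod>j<n. 1 - a ^ 2 * (q ^ 2) ^ j) \<longlonglongrightarrow> qpoch (a ^ 2) (q ^ 2)"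
    using assms by (intro tendsto_qpoch_fps) auto
  ultimately show "?P \<longlonglongrightarrow> qpoch (a ^ 2) (q ^ 2)" by simp
qed

section \<open>Gaussian binomial coefficients\<close>

fun qbinom :: "'a :: comm_ring_1 \<Rightarrow> nat \<Rightarrow> nat \<Rightarrow> 'a" where
  "qbinom q n 0 = 1"
| "qbinom q 0 (Suc r) = 0"
| "qbinom q (Suc n) (Suc r) = qbinom q n r + q ^ Suc r * qbinom q n (Suc r)"

lemma qbinom_eq_0: "n < r \<Longrightarrow> qbinom q n r = 0"
  by (induction q n r rule: qbinom.induct) auto

lemma qbinom_self: "qbinom q n n = 1"
  by (induction n) (auto simp: qbinom_eq_0)

text \<open>
  The second Pascal recurrence. The defining recurrence serves to append a factor
  $1 + b(ab)^n$ to the finite triple product, this one to append a factor $1 + a(ab)^m$.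
\<close>

lemma qbinom_Suc_Suc_dual:
  "r \<le> n \<Longrightarrow> qbinom q (Suc n) (Suc r) = qbinom q n (Suc r) + q ^ (n - r) * qbinom q n r"
proof (induction n arbitrary: r)
  case (Suc n)
  show ?case
  proof (cases "r = Suc n")
    case True
    thus ?thesis by (simp add: qbinom_eq_0 qbinom_self)
  next
    case False
    with Suc.prems have r: "r \<le> n" by simp
    show ?thesis
    proof (cases r)
      case 0
      have "qbinom q (Suc (Suc n)) (Suc 0) = 1 + q * qbinom q (Suc n) (Suc 0)"
        by simp
      also have "qbinom q (Suc n) (Suc 0) = qbinom q n (Suc 0) + q ^ n"
        using Suc.IH[of 0] by simp
      finally show ?thesis
        using 0 by (simp add: algebra_simps)
    next
      case (Suc s)
      have "qbinom q (Suc (Suc n)) (Suc r) = qbinom q (Suc n) (Suc s) + q ^ Suc r * qbinom q (Suc n) (Suc r)"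
        using Suc by simp
      also have "qbinom q (Suc n) (Suc s) = qbinom q n (Suc s) + q ^ (n - s) * qbinom q n s"
        using Suc.IH[of s] r Suc by simp
      also have "qbinom q (Suc n) (Suc r) = qbinom q n (Suc r) + q ^ (n - r) * qbinom q n r"
        using Suc.IH[of r] r by simp
      also have "q ^ Suc r * (qbinom q n (Suc r) + q ^ (n - r) * qbinom q n r) =
         q ^ Suc r * qbinom q n (Suc r) + q ^ (n - s) * q ^ r * qbinom q n r"
      proof -
        have "q ^ Suc r * q ^ (n - r) = q ^ (n - s) * q ^ r"
          unfolding power_add [symmetric] using r Suc by simp
        thus ?thesis by (simp only: distrib_left mult.assoc [symmetric])
      qed
      finally show ?thesis
        using Suc r by (simp add: algebra_simps)
    qed
  qed
qed (auto)

text \<open>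
  The finite Pochhammer symbol $(q;q)_n$, which is the $q$-factorial of \<open>n\<close> without its
  denominator $(1-q)^n$.
\<close>

definition qfact :: "'a :: comm_ring_1 \<Rightarrow> nat \<Rightarrow> 'a" where
  "qfact q n = (\<Prod>j<n. 1 - q * q ^ j)"

lemma qbinom_qfact:
  "r \<le> n \<Longrightarrow> qbinom q n r * (qfact q r * qfact q (n - r)) = qfact q n"
proof (induction n arbitrary: r)
  case (Suc n)
  show ?case
  proof (cases r)
    case 0
    thus ?thesis by (simp add: qfact_def)
  next
    case (Suc s)
    with Suc.prems have s: "s \<le> n" by simp
    show ?thesis
    proof (cases "s = n")
      case True
      thus ?thesis using Suc by (simp only: qbinom_self) (simp add: qfact_def)
    next
      case False
      hence 1: "qfact q (n - s) = qfact q (n - Suc s) * (1 - q ^ (n - s))"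
        using s by (simp add: qfact_def Suc_diff_Suc[symmetric, of s n] del: Suc_diff_Suc)
      have 2: "qfact q (Suc s) = qfact q s * (1 - q ^ Suc s)"
        by (simp add: qfact_def)
      have "qbinom q (Suc n) r * (qfact q r * qfact q (Suc n - r)) =
        (1 - q ^ Suc s) * (qbinom q n s * (qfact q s * qfact q (n - s))) +
        q ^ Suc s * (1 - q ^ (n - s)) * (qbinom q n (Suc s) * (qfact q (Suc s) * qfact q (n - Suc s)))"
        using Suc by (simp add: 1 2 algebra_simps)
      also have "\<dots> = (1 - q ^ Suc s * q ^ (n - s)) * qfact q n"
        using Suc.IH[of s] Suc.IH[of "Suc s"] s False by (simp add: algebra_simps)
      also have "q ^ Suc s * q ^ (n - s) = q * q ^ n"
        unfolding power_add [symmetric] using s by simp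
      finally show ?thesis by (simp add: qfact_def)
    qed
  qed
qed (auto simp: qfact_def)

section \<open>The Jacobi triple product\<close>

text \<open>
  This is the term $a^{k(k+1)/2} b^{k(k-1)/2}$ of Ramanujan's theta function $f(a,b)$. In this
  form both exponents are nonnegative for every integer \<open>k\<close>, so that the triple product needs no
  negative powers and makes sense in any commutative ring.
\<close>

definition theta_term :: "'a :: comm_ring_1 \<Rightarrow> 'a \<Rightarrow> int \<Rightarrow> 'a" where
  "theta_term a b k = a ^ nat (k * (k + 1) div 2) * b ^ nat (k * (k - 1) div 2)"

lemma triangular_Suc: "(k + 1) * (k + 1 + 1) div 2 = k * (k + 1) div 2 + (k + 1 :: int)"
proof -
  have "(k + 1) * (k + 1 + 1) = k * (k + 1) + (k + 1) * 2" by (simp add: algebra_simps)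
  thus ?thesis by simp
qed

lemma double_triangular: "2 * (k * (k - 1) div 2) = k * (k - 1 :: int)"
  by (rule dvd_mult_div_cancel) auto

lemma triangular_step: "k * (k + 1) div 2 = k * (k - 1) div 2 + (k :: int)"
  using triangular_Suc[of "k - 1"] by (simp add: mult.commute)

lemma triangular_nonneg: "k * (k + 1) div 2 \<ge> (0 :: int)"
proof (cases "k \<ge> 0")
  case False
  hence "(- k) * (- (k + 1)) \<ge> 0" by (intro mult_nonneg_nonneg) auto
  thus ?thesis by (simp add: algebra_simps)
qed auto

text \<open>
  Consecutive terms have the quotient $a(ab)^k$. Multiplied by $(ab)^{m-k}$ this is
  $a(ab)^m$, the second summand of the factor that the finite product gains when \<open>m\<close> grows;
  \<open>k \<le> m\<close> keeps the exponent nonnegative.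
\<close>

lemma theta_term_up:
  assumes "k \<le> int m"
  shows "a * (a * b) ^ m * theta_term a b k = (a * b) ^ nat (int m - k) * theta_term a b (k + 1)"
proof -
  have "Suc m + nat (k * (k + 1) div 2) = nat (int m - k) + nat ((k + 1) * (k + 1 + 1) div 2)"
    using assms triangular_nonneg[of k] triangular_Suc[of k] triangular_nonneg[of "k+1"] by linarith
  moreover have "m + nat (k * (k - 1) div 2) = nat (int m - k) + nat ((k + 1) * (k + 1 - 1) div 2)"
    using assms triangular_nonneg[of "k-1"] triangular_Suc[of "k-1"] triangular_nonneg[of k]
    by (simp add: mult.commute)
  moreover have "a * (a * b) ^ m * theta_term a b k =
     a ^ (Suc m + nat (k * (k + 1) div 2)) * b ^ (m + nat (k * (k - 1) div 2))"
    by (simp add: theta_term_def power_add power_mult_distrib mult_ac)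
  ultimately show ?thesis
    by (simp only: theta_term_def power_add power_mult_distrib mult_ac)
qed

lemma theta_term_commute: "theta_term b a k = theta_term a b (- k)"
proof -
  have "- k * (- k + 1) = k * (k - 1)" "- k * (- k - 1) = k * (k + 1)"
    by (simp_all add: algebra_simps)
  thus ?thesis unfolding theta_term_def by (simp add: mult.commute)
qed

lemma theta_term_down:
  assumes "- int n \<le> k"
  shows "b * (a * b) ^ n * theta_term a b k = (a * b) ^ nat (int n + k) * theta_term a b (k - 1)"
  using theta_term_up[of "- k" n b a] assms
  by (simp add: theta_term_commute[of b a] mult.commute[of b a])

text \<open>
  A factor $1 + a(ab)^m$ sends each term to itself plus a multiple of the next one, and a factor
  $1 + b(ab)^n$ to itself plus a multiple of the previous one. The powers of $ab$ that come with
  the neighbour are the ones in the two Pascal recurrences.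
\<close>

lemma finite_jacobi_triple_product:
  "(\<Prod>j<m. 1 + a * (a * b) ^ j) * (\<Prod>j<n. 1 + b * (a * b) ^ j) =
   (\<Sum>r\<le>m+n. qbinom (a * b) (m + n) r * theta_term a b (int r - int n))"
proof (induction n)
  case 0
  show ?case
  proof (induction m)
    case 0
    thus ?case by (simp add: theta_term_def)
  next
    case (Suc m)
    let ?t = "\<lambda>r. theta_term a b (int r)" and ?B = "qbinom (a * b)"
    have up: "?B m r * ?t r * (a * (a * b) ^ m) = (a * b) ^ (m - r) * ?B m r * ?t (Suc r)"
      if "r \<le> m" for r
      using arg_cong[OF theta_term_up[of "int r" m a b], of "\<lambda>x. ?B m r * x"] that
      by (simp add: mult_ac nat_diff_distrib add.commute)
    have "(\<Prod>j<Suc m. 1 + a * (a * b) ^ j) = (\<Sum>r\<le>m. ?B m r * ?t r) * (1 + a * (a * b) ^ m)"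
      using Suc by simp
    also have "\<dots> = (\<Sum>r\<le>m. ?B m r * ?t r) + (\<Sum>r\<le>m. ?B m r * ?t r * (a * (a * b) ^ m))"
      by (simp only: distrib_left mult_1_right sum_distrib_right)
    also have "(\<Sum>r\<le>m. ?B m r * ?t r * (a * (a * b) ^ m)) =
        (\<Sum>r\<le>m. (a * b) ^ (m - r) * ?B m r * ?t (Suc r))"
      using up by (intro sum.cong) auto
    also have "(\<Sum>r\<le>m. ?B m r * ?t r) = (\<Sum>r\<le>Suc m. ?B m r * ?t r)"
      by (simp add: qbinom_eq_0)
    also have "\<dots> = ?t 0 + (\<Sum>r\<le>m. ?B m (Suc r) * ?t (Suc r))"
      by (subst sum.atMost_Suc_shift) simp
    also have "\<dots> + (\<Sum>r\<le>m. (a * b) ^ (m - r) * ?B m r * ?t (Suc r)) =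
        ?t 0 + (\<Sum>r\<le>m. ?B (Suc m) (Suc r) * ?t (Suc r))"
      unfolding add.assoc sum.distrib [symmetric]
      by (intro arg_cong2[of _ _ _ _ "(+)"] sum.cong refl, subst qbinom_Suc_Suc_dual)
         (simp_all add: algebra_simps)
    also have "\<dots> = (\<Sum>r\<le>Suc m. ?B (Suc m) r * ?t r)"
      by (subst sum.atMost_Suc_shift) simp
    finally show ?case by simp
  qed
next
  case (Suc n)
  let ?t = "\<lambda>r. theta_term a b (int r - int (Suc n))" and ?B = "qbinom (a * b)"
  let ?N = "m + n"
  have t: "theta_term a b (int r - int n) = ?t (Suc r)" for r
    by simp
  have down: "?B ?N r * ?t (Suc r) * (b * (a * b) ^ n) = (a * b) ^ r * ?B ?N r * ?t r" for r
    using arg_cong[OF theta_term_down[of n "int r - int n" b a], of "\<lambda>x. ?B ?N r * x"]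
    by (simp add: mult_ac diff_diff_eq add.commute)
  have "(\<Prod>j<m. 1 + a * (a * b) ^ j) * (\<Prod>j<Suc n. 1 + b * (a * b) ^ j) =
     (\<Sum>r\<le>?N. ?B ?N r * ?t (Suc r)) * (1 + b * (a * b) ^ n)"
    using Suc by (simp only: prod.lessThan_Suc mult.assoc [symmetric] t)
  also have "\<dots> = (\<Sum>r\<le>?N. ?B ?N r * ?t (Suc r)) + (\<Sum>r\<le>?N. ?B ?N r * ?t (Suc r) * (b * (a * b) ^ n))"
    by (simp only: distrib_left mult_1_right sum_distrib_right)
  also have "(\<Sum>r\<le>?N. ?B ?N r * ?t (Suc r) * (b * (a * b) ^ n)) = (\<Sum>r\<le>?N. (a * b) ^ r * ?B ?N r * ?t r)"
    by (intro sum.cong refl down)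
  also have "\<dots> = (\<Sum>r\<le>Suc ?N. (a * b) ^ r * ?B ?N r * ?t r)"
    by (simp add: qbinom_eq_0)
  also have "\<dots> = ?t 0 + (\<Sum>r\<le>?N. (a * b) ^ Suc r * ?B ?N (Suc r) * ?t (Suc r))"
    by (subst sum.atMost_Suc_shift) simp
  also have "(\<Sum>r\<le>?N. ?B ?N r * ?t (Suc r)) + \<dots> =
      ?t 0 + (\<Sum>r\<le>?N. ?B (Suc ?N) (Suc r) * ?t (Suc r))"
    by (simp add: sum.distrib [symmetric] algebra_simps)
  also have "\<dots> = (\<Sum>r\<le>Suc ?N. ?B (Suc ?N) r * ?t r)"
    by (subst sum.atMost_Suc_shift) simp
  finally show ?case by simp
qed

text \<open>The two exponents add up to $k^2 \geq |k|$, and $a$ and $b$ are multiples of $X$.\<close>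

lemma theta_term_nth_eq_0:
  fixes a b :: "'a :: comm_ring_1 fps"
  assumes "fps_nth a 0 = 0" "fps_nth b 0 = 0" "int n < \<bar>k\<bar>"
  shows "fps_nth (theta_term a b k) n = 0"
proof -
  define u v where "u = nat (k * (k + 1) div 2)" and "v = nat (k * (k - 1) div 2)"
  have pos: "k * (k + 1) div 2 \<ge> 0" "k * (k - 1) div 2 \<ge> 0"
    using triangular_nonneg[of k] triangular_nonneg[of "k - 1"] by (simp_all add: mult.commute)
  have "k * (k + 1) div 2 = k * (k - 1) div 2 + k"
    using triangular_Suc[of "k - 1"] by (simp add: mult.commute)
  hence n: "n < u + v"
    using assms(3) pos unfolding u_def v_def by linarith
  have "fps_nth (a ^ u) i * fps_nth (b ^ v) (n - i) = 0" if "i \<le> n" for i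
  proof (cases "i < u")
    case True
    thus ?thesis using assms(1) by (simp add: startsby_zero_power_prefix)
  next
    case False
    hence "n - i < v" using n that by linarith
    thus ?thesis using assms(2) by (simp add: startsby_zero_power_prefix)
  qed
  thus ?thesis
    unfolding theta_term_def u_def [symmetric] v_def [symmetric]
    by (simp add: fps_mult_nth)
qed

lemma fps_cutoff_qfact:
  fixes q :: "'a :: comm_ring_1 fps"
  assumes "fps_nth q 0 = 0" "n \<le> m"
  shows "fps_cutoff (Suc n) (qfact q m) = fps_cutoff (Suc n) (qfact q n)"
  using assms(2)
proof (induction m rule: dec_induct)
  case (step m)
  have "fps_cutoff (Suc n) (1 - q * q ^ m) = fps_cutoff (Suc n) 1"
    unfolding fps_cutoff_eq_fps_cutoff_iff power_Suc [symmetric]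
    using step assms(1) by (auto simp: startsby_zero_power_prefix simp del: power_Suc)
  from fps_cutoff_mult_cong[OF step.IH this] show ?case
    by (simp add: qfact_def)
qed simp

text \<open>
  Up to order \<open>n\<close>, all $(q;q)_j$ with $j \geq n$ agree with the unit $E = (q;q)_n$. So
  \<open>qbinom_qfact\<close> says that $E^2$ times the coefficient is $E$ up to that order, and a factor $E$
  can be cancelled. This is the formal version of the fact
  that central $q$-binomial coefficients tend to $1/(q;q)_\infty$.
\<close>

lemma fps_cutoff_qfact_qbinom:
  fixes q :: "'a :: field fps"
  assumes "fps_nth q 0 = 0" "n \<le> r" "r \<le> m" "n \<le> m - r" "n \<le> l"
  shows "fps_cutoff (Suc n) (qfact q l * qbinom q m r) = fps_cutoff (Suc n) 1"
proof -
  define E where "E = qfact q n"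
  have E0: "fps_nth E 0 = 1"
    unfolding E_def qfact_def using assms(1) by (induction n) auto
  have inv: "E * inverse E = 1"
    using E0 by (intro inverse_mult_eq_1') auto
  have cut: "fps_cutoff (Suc n) (qfact q j) = fps_cutoff (Suc n) E" if "n \<le> j" for j
    unfolding E_def by (rule fps_cutoff_qfact) (use assms that in auto)
  have "fps_cutoff (Suc n) (qbinom q m r * (E * E)) =
        fps_cutoff (Suc n) (qbinom q m r * (qfact q r * qfact q (m - r)))"
    by (intro fps_cutoff_mult_cong refl cut [symmetric] assms)
  also have "\<dots> = fps_cutoff (Suc n) E"
    unfolding qbinom_qfact[OF \<open>r \<le> m\<close>] by (rule cut) (use assms in linarith)
  finally have *: "fps_cutoff (Suc n) (qbinom q m r * (E * E)) = fps_cutoff (Suc n) E" .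
  have "fps_cutoff (Suc n) (qfact q l * qbinom q m r) = fps_cutoff (Suc n) (E * qbinom q m r)"
    by (intro fps_cutoff_mult_cong refl cut assms)
  also have "E * qbinom q m r = (qbinom q m r * (E * E)) * inverse E"
    using inv by (simp add: mult_ac)
  also have "fps_cutoff (Suc n) \<dots> = fps_cutoff (Suc n) (E * inverse E)"
    by (intro fps_cutoff_mult_cong * refl)
  finally show ?thesis by (simp only: inv)
qed

text \<open>
  The coefficient of $X^N$ can be read off the finite identity with $m = n \geq 2N$ factors,
  multiplied by $(ab;ab)_n$: terms with $|k| > N$ start beyond order \<open>N\<close>, and for the others the
  coefficient in front of the theta term agrees with 1 up to that order.
\<close>

theorem jacobi_triple_product_fps:
  fixes a b :: "'a :: {field, t2_space} fps"
  assumes "a \<noteq> 0" "b \<noteq> 0" "fps_nth a 0 = 0" "fps_nth b 0 = 0"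
  shows "(theta_term a b has_sum (qpoch (a * b) (a * b) * (qpoch (-a) (a * b) * qpoch (-b) (a * b)))) UNIV"
    (is "(_ has_sum ?S) _")
proof (rule has_sum_fpsI)
  fix N :: nat
  let ?q = "a * b"
  have supp: "{k \<in> UNIV. fps_nth (theta_term a b k) N \<noteq> 0} \<subseteq> {- int n..int n}" if "N \<le> n" for n
  proof
    fix k assume k: "k \<in> {k \<in> UNIV. fps_nth (theta_term a b k) N \<noteq> 0}"
    have "\<not> int N < \<bar>k\<bar>"
    proof
      assume "int N < \<bar>k\<bar>"
      from theta_term_nth_eq_0[OF assms(3,4) this] k show False by simp
    qed
    with that show "k \<in> {- int n..int n}" by auto
  qed
  show "finite {k \<in> UNIV. fps_nth (theta_term a b k) N \<noteq> 0}"
    by (rule finite_subset[OF supp[OF order_refl]]) auto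
  let ?P = "\<lambda>n. (\<Prod>j<n. 1 - ?q * ?q ^ j) * ((\<Prod>j<n. 1 - (-a) * ?q ^ j) * (\<Prod>j<n. 1 - (-b) * ?q ^ j))"
  have "?P \<longlonglongrightarrow> ?S"
    using assms by (intro tendsto_mult_fps tendsto_qpoch_fps) auto
  hence "\<forall>\<^sub>F n in sequentially. fps_nth (?P n) N = fps_nth ?S N"
    unfolding tendsto_fps_iff by blast
  moreover have "\<forall>\<^sub>F n in sequentially. 2 * N \<le> n"
    by (rule eventually_ge_at_top)
  ultimately have "\<forall>\<^sub>F n in sequentially. fps_nth (?P n) N = fps_nth ?S N \<and> 2 * N \<le> n"
    by (rule eventually_conj)
  from eventually_happens'[OF sequentially_bot this]
  obtain n where n: "fps_nth (?P n) N = fps_nth ?S N" "2 * N \<le> n"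
    by blast
  have "?P n = (\<Sum>r\<le>2*n. (qfact ?q n * qbinom ?q (2*n) r) * theta_term a b (int r - int n))"
  proof -
    (* The symbols qpoch (-a) and qpoch (-b) have the factors 1 + a q^j and 1 + b q^j. *)
    have "?P n = qfact ?q n * ((\<Prod>j<n. 1 + a * ?q ^ j) * (\<Prod>j<n. 1 + b * ?q ^ j))"
      by (simp add: qfact_def)
    thus ?thesis
      by (simp only: finite_jacobi_triple_product sum_distrib_left mult.assoc mult_2)
  qed
  hence "fps_nth (?P n) N =
     (\<Sum>r\<le>2*n. fps_nth ((qfact ?q n * qbinom ?q (2*n) r) * theta_term a b (int r - int n)) N)"
    by (simp only: fps_sum_nth)
  also have "\<dots> = (\<Sum>r\<le>2*n. fps_nth (theta_term a b (int r - int n)) N)"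
  proof (intro sum.cong refl)
    fix r assume "r \<in> {..2*n}"
    hence r: "r \<le> 2 * n" by simp
    let ?f = "qfact ?q n * qbinom ?q (2*n) r" and ?t = "theta_term a b (int r - int n)"
    have "fps_cutoff (Suc N) (?f * ?t) = fps_cutoff (Suc N) (1 * ?t)"
    proof (cases "int N < \<bar>int r - int n\<bar>")
      case True
      have "fps_cutoff (Suc N) ?t = 0"
        using theta_term_nth_eq_0[OF assms(3,4)] True by (auto simp: fps_eq_iff)
      from fps_cutoff_mult_cong[of "Suc N" ?f ?f ?t 0] this show ?thesis
        by simp
    next
      case False
      hence "N \<le> r" "N \<le> 2 * n - r" "N \<le> n"
        using n(2) r by linarith+
      thus ?thesis
        using assms r by (intro fps_cutoff_mult_cong fps_cutoff_qfact_qbinom refl) auto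
    qed
    thus "fps_nth (?f * ?t) N = fps_nth ?t N"
      by (simp add: fps_cutoff_eq_fps_cutoff_iff)
  qed
  also have "\<dots> = (\<Sum>k\<in>{- int n..int n}. fps_nth (theta_term a b k) N)"
    by (rule sum.reindex_bij_witness[of _ "\<lambda>k. nat (k + int n)" "\<lambda>r. int r - int n"]) auto
  also have "\<dots> = (\<Sum>k | k \<in> UNIV \<and> fps_nth (theta_term a b k) N \<noteq> 0. fps_nth (theta_term a b k) N)"
    by (rule sum.mono_neutral_right) (use supp[of n] n(2) in auto)
  finally show "fps_nth ?S N = (\<Sum>k | k \<in> UNIV \<and> fps_nth (theta_term a b k) N \<noteq> 0. fps_nth (theta_term a b k) N)"
    using n(1) by simp
qed


lemma theta_term_monomial:
  "theta_term (x ^ i) (x ^ j) k = x ^ nat (int i * (k * (k + 1) div 2) + int j * (k * (k - 1) div 2))"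
  using triangular_nonneg[of k] triangular_nonneg[of "k - 1"]
  by (simp add: theta_term_def power_mult [symmetric] power_add [symmetric]
      nat_add_distrib nat_mult_distrib mult.commute)

section \<open>Gauss's series\<close>

text \<open>
  As \<open>k\<close> runs through the integers, $k(2k-1)$ runs through the triangular numbers, once each. The
  triple product for $a$ and $b = a^3$ yields $(a^4,-a,-a^3;a^4)_\infty$; the two factors with a
  minus sign make up $(-a;a^2)_\infty$, and $(a;a^2)_\infty(-a;a^2)_\infty = (a^2;a^4)_\infty$
  completes $(a^4;a^4)_\infty$ to $(a^2;a^2)_\infty$.
\<close>

theorem gauss_triangular_fps:
  fixes a :: "'a :: {field, t2_space} fps"
  assumes "a \<noteq> 0" "fps_nth a 0 = 0"
  shows "((\<lambda>k::int. a ^ nat (k * (2 * k - 1))) has_sum (qpoch (a ^ 2) (a ^ 2) / qpoch a (a ^ 2))) UNIV"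
proof -
  have exponent: "theta_term a (a ^ 3) = (\<lambda>k. a ^ nat (k * (2 * k - 1)))"
  proof
    fix k :: int
    have "k * (k + 1) div 2 + 3 * (k * (k - 1) div 2) = 2 * (2 * (k * (k - 1) div 2)) + k"
      unfolding triangular_step[of k] by simp
    also have "\<dots> = k * (2 * k - 1)"
      unfolding double_triangular by (simp add: algebra_simps)
    finally have "k * (k + 1) div 2 + 3 * (k * (k - 1) div 2) = k * (2 * k - 1)" .
    thus "theta_term a (a ^ 3) k = a ^ nat (k * (2 * k - 1))"
      using theta_term_monomial[of a 1 3 k] by simp
  qed
  have q4: "a * a ^ 3 = a ^ 4" "(a ^ 2) ^ 2 = a ^ 4" "a ^ 2 * a ^ 2 = a ^ 4" "- a * a ^ 2 = - (a ^ 3)"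
    by (simp_all add: eval_nat_numeral mult.assoc)
  have "qpoch (a ^ 4) (a ^ 4) * (qpoch (- a) (a ^ 4) * qpoch (- (a ^ 3)) (a ^ 4)) * qpoch a (a ^ 2) =
        qpoch (a ^ 4) (a ^ 4) * (qpoch a (a ^ 2) * qpoch (- a) (a ^ 2))"
    using qpoch_dissect_fps[of "- a" "a ^ 2"] assms unfolding q4 by (simp add: mult_ac)
  also have "\<dots> = qpoch (a ^ 2) (a ^ 4) * qpoch (a ^ 4) (a ^ 4)"
    using qpoch_times_qpoch_uminus_fps[of a "a ^ 2"] assms unfolding q4 by (simp add: mult_ac)
  also have "\<dots> = qpoch (a ^ 2) (a ^ 2)"
    using qpoch_dissect_fps[of "a ^ 2" "a ^ 2"] assms unfolding q4 by simp
  finally have "qpoch (a ^ 4) (a ^ 4) * (qpoch (- a) (a ^ 4) * qpoch (- (a ^ 3)) (a ^ 4)) =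
      qpoch (a ^ 2) (a ^ 2) / qpoch a (a ^ 2)"
    using qpoch_fps_nonzero[of a "a ^ 2"] assms by (metis nonzero_mult_div_cancel_right power_not_zero fps_nth_power_0 zero_power2)
  with jacobi_triple_product_fps[of a "a ^ 3"] assms show ?thesis
    unfolding exponent q4 by simp
qed

text \<open>
  The left-hand side is the difference of Gauss's series at $X$ and at $-X$. For $k = 2m + 1$ the
  exponent is $k(2k-1) = 8m^2 + 6m + 1$, and $14\,m(m+1)/2 + 2\,m(m-1)/2 = 8m^2 + 6m$.
\<close>

lemma odd_part_of_gauss_series:
  defines "X \<equiv> (fps_X :: 'a :: {field, t2_space} fps)"
  shows "qpoch (X ^ 2) (X ^ 2) / qpoch X (X ^ 2) - qpoch (X ^ 2) (X ^ 2) / qpoch (- X) (X ^ 2) =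
     2 * X * qpochs [X ^ 16, - (X ^ 2), - (X ^ 14)] (X ^ 16)"
proof (rule has_sum_unique_fps)
  let ?f = "\<lambda>k::int. X ^ nat (k * (2 * k - 1)) - (- X) ^ nat (k * (2 * k - 1))"
  have [simp]: "X \<noteq> 0" "fps_nth X 0 = 0" by (simp_all add: X_def)
  have "((\<lambda>k::int. (- X) ^ nat (k * (2 * k - 1))) has_sum (qpoch (X ^ 2) (X ^ 2) / qpoch (- X) (X ^ 2))) UNIV"
    using gauss_triangular_fps[of "- X"] by simp
  thus "(?f has_sum (qpoch (X ^ 2) (X ^ 2) / qpoch X (X ^ 2) - qpoch (X ^ 2) (X ^ 2) / qpoch (- X) (X ^ 2))) UNIV"
    by (intro has_sum_diff_fps gauss_triangular_fps) simp_all
  have exponent: "k * (2 * k - 1) \<ge> 0" for k :: int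
    by (cases "k \<ge> 1") (auto intro: mult_nonneg_nonneg mult_nonpos_nonpos)
  (* Nonnegativity makes the parity of the natural exponent that of the integer, hence of k. *)
  have even: "?f k = 0" if "even k" for k
    using that exponent[of k] by (simp add: even_nat_iff)
  have "2 * X * theta_term (X ^ 14) (X ^ 2) m = ?f (2 * m + 1)" for m
  proof -
    have "14 * (m * (m + 1) div 2) + 2 * (m * (m - 1) div 2) = 8 * (m * m) + 6 * m"
    proof -
      have "14 * (m * (m + 1) div 2) + 2 * (m * (m - 1) div 2) = 8 * (2 * (m * (m - 1) div 2)) + 14 * m"
        unfolding triangular_step[of m] by simp
      thus ?thesis
        unfolding double_triangular by (simp add: algebra_simps)
    qed
    moreover have "(2 * m + 1) * (2 * (2 * m + 1) - 1) = 8 * (m * m) + 6 * m + 1"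
      by (simp add: algebra_simps)
    moreover have "8 * (m * m) + 6 * m \<ge> 0"
      using calculation(1) triangular_nonneg[of m] triangular_nonneg[of "m - 1"]
      by (simp only: mult.commute[of "m - 1"] diff_add_cancel)
    ultimately show ?thesis
      using theta_term_monomial[of X 14 2 m] by (simp add: nat_add_distrib even_nat_iff)
  qed
  hence "((\<lambda>m. ?f (2 * m + 1)) has_sum (2 * X * (qpoch (X ^ 16) (X ^ 16) * (qpoch (- (X ^ 14)) (X ^ 16) * qpoch (- (X ^ 2)) (X ^ 16))))) UNIV"
    using has_sum_cmult_right_fps[OF jacobi_triple_product_fps[of "X ^ 14" "X ^ 2"], of "2 * X"]
    by (simp add: power_add [symmetric])
  hence "(?f has_sum (2 * X * qpochs [X ^ 16, - (X ^ 2), - (X ^ 14)] (X ^ 16))) (range (\<lambda>m. 2 * m + 1))"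
    by (subst has_sum_reindex) (auto simp: inj_on_def o_def qpochs_def mult_ac)
  also have "?this \<longleftrightarrow> (?f has_sum (2 * X * qpochs [X ^ 16, - (X ^ 2), - (X ^ 14)] (X ^ 16))) UNIV"
  proof (rule has_sum_cong_neutral)
    fix k :: int assume "k \<in> UNIV - range (\<lambda>m. 2 * m + 1)"
    hence "even k" by (metis DiffE oddE rangeI)
    thus "?f k = 0" by (rule even)
  qed auto
  finally show "(?f has_sum (2 * X * qpochs [X ^ 16, - (X ^ 2), - (X ^ 14)] (X ^ 16))) UNIV" .
qed

section \<open>Generating functions of multisets\<close>

lemma finite_multisets_of_weight:
  fixes w :: "'b \<Rightarrow> nat"
  assumes "finite A" "\<And>p. p \<in> A \<Longrightarrow> 0 < w p"
  shows "finite {P. set_mset P \<subseteq> A \<and> (\<Sum>p\<in>#P. w p) = n}"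
proof (rule finite_subset)
  show "{P. set_mset P \<subseteq> A \<and> (\<Sum>p\<in>#P. w p) = n} \<subseteq> (\<Union>k\<le>n. {P. set_mset P \<subseteq> A \<and> size P = k})"
  proof safe
    fix P assume P: "set_mset P \<subseteq> A" "n = (\<Sum>p\<in>#P. w p)"
    have "size P = (\<Sum>p\<in>#P. 1)" by simp
    also have "\<dots> \<le> (\<Sum>p\<in>#P. w p)"
      using P(1) assms(2) by (intro sum_mset_mono) (force simp: Suc_le_eq)
    finally show "P \<in> (\<Union>k\<le>\<Sum>p\<in>#P. w p. {P. set_mset P \<subseteq> A \<and> size P = k})"
      using P(1) by auto
  qed
  show "finite (\<Union>k\<le>n. {P. set_mset P \<subseteq> A \<and> size P = k})"
    using finite_multisets_of_size[OF assms(1)] by (simp add: multisets_of_size_def)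
qed

text \<open>
  Multiplying by the factor of a new element \<open>x\<close> subtracts from the multisets over
  \<open>insert x A\<close> those that arise from a smaller one by adding a copy of \<open>x\<close>. What remains are the
  multisets without \<open>x\<close>.
\<close>

lemma multiset_generating_function:
  fixes w :: "'b \<Rightarrow> nat" and c :: "'b \<Rightarrow> 'a :: comm_ring_1"
  assumes "finite A" "\<And>p. p \<in> A \<Longrightarrow> 0 < w p"
  shows "(\<Prod>p\<in>A. 1 - fps_const (c p) * fps_X ^ w p) *
         Abs_fps (\<lambda>n. \<Sum>P | set_mset P \<subseteq> A \<and> (\<Sum>p\<in>#P. w p) = n. \<Prod>p\<in>#P. c p) = 1"
  using assms
proof (induction A rule: finite_induct)
  case empty
  have "{P. set_mset P \<subseteq> {} \<and> (\<Sum>p\<in>#P. w p) = n} = (if n = 0 then {{#}} else {})" for n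
    by auto
  thus ?case by (simp add: fps_eq_iff)
next
  case (insert x A)
  let ?S = "\<lambda>A n. {P. set_mset P \<subseteq> A \<and> (\<Sum>p\<in>#P. w p) = n}"
  let ?G = "\<lambda>A. Abs_fps (\<lambda>n. \<Sum>P\<in>?S A n. \<Prod>p\<in>#P. c p)"
  have "fps_nth ((1 - fps_const (c x) * fps_X ^ w x) * ?G (insert x A)) n = fps_nth (?G A) n" for n
  proof (cases "n < w x")
    case True
    have "x \<notin># P" if "P \<in> ?S (insert x A) n" for P
    proof
      assume "x \<in># P"
      from multi_member_split[OF this] that True show False by auto
    qed
    hence "?S (insert x A) n = ?S A n" by blast
    with True show ?thesis
      by (simp add: left_diff_distrib mult.assoc fps_X_power_mult_nth)
  next
    case False
    have split: "?S (insert x A) n = ?S A n \<union> add_mset x ` ?S (insert x A) (n - w x)"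
    proof (intro equalityI subsetI)
      fix P assume P: "P \<in> ?S (insert x A) n"
      show "P \<in> ?S A n \<union> add_mset x ` ?S (insert x A) (n - w x)"
      proof (cases "x \<in># P")
        case True
        from multi_member_split[OF this] obtain P' where "P = add_mset x P'" by blast
        with P show ?thesis by auto
      qed (use P in blast)
    qed (use False in auto)
    have "(\<Sum>P\<in>?S (insert x A) n. \<Prod>p\<in>#P. c p) =
       (\<Sum>P\<in>?S A n. \<Prod>p\<in>#P. c p) + (\<Sum>P\<in>add_mset x ` ?S (insert x A) (n - w x). \<Prod>p\<in>#P. c p)"
      unfolding split
    proof (rule sum.union_disjoint)
      show "finite (?S A n)" "finite (add_mset x ` ?S (insert x A) (n - w x))"
        using insert by (auto intro!: finite_imageI finite_multisets_of_weight)
      have "x \<notin># P" if "P \<in> ?S A n" for P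
        using that insert.hyps by blast
      moreover have "x \<in># P" if "P \<in> add_mset x ` ?S (insert x A) (n - w x)" for P
        using that by fastforce
      ultimately show "?S A n \<inter> add_mset x ` ?S (insert x A) (n - w x) = {}"
        by blast
    qed
    also have "(\<Sum>P\<in>add_mset x ` ?S (insert x A) (n - w x). \<Prod>p\<in>#P. c p) =
       c x * (\<Sum>P\<in>?S (insert x A) (n - w x). \<Prod>p\<in>#P. c p)"
      by (subst sum.reindex) (auto simp: sum_distrib_left inj_on_def)
    finally show ?thesis
      using False by (simp add: left_diff_distrib mult.assoc fps_X_power_mult_nth)
  qed
  hence step: "(1 - fps_const (c x) * fps_X ^ w x) * ?G (insert x A) = ?G A"
    by (intro fps_ext)
  have "(\<Prod>p\<in>insert x A. 1 - fps_const (c p) * fps_X ^ w p) * ?G (insert x A) =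
     (\<Prod>p\<in>A. 1 - fps_const (c p) * fps_X ^ w p) * ((1 - fps_const (c x) * fps_X ^ w x) * ?G (insert x A))"
    unfolding prod.insert[OF insert.hyps] by (simp only: mult_ac)
  also have "\<dots> = (\<Prod>p\<in>A. 1 - fps_const (c p) * fps_X ^ w p) * ?G A"
    unfolding step ..
  also have "\<dots> = 1"
    using insert by simp
  finally show ?case .
qed

section \<open>Two-color partitions\<close>

definition red_odd_parts :: "(nat \<times> color) multiset \<Rightarrow> nat" where
  "red_odd_parts P = size {#p \<in># P. snd p = Red \<and> odd (fst p)#}"

definition kinds :: "nat \<Rightarrow> (nat \<times> color) set" where
  "kinds M = (\<lambda>j. (2 * j + 1, Red)) ` {..<M} \<union>
     ((\<lambda>j. (2 * j + 1, Blue)) ` {..<M} \<union> (\<lambda>j. (2 * j + 2, Blue)) ` {..<M})"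

lemma mem_kinds:
  "p \<in> kinds M \<longleftrightarrow> 0 < fst p \<and> fst p \<le> 2 * M \<and> (even (fst p) \<longrightarrow> snd p = Blue)"
proof (cases p)
  case (Pair i x)
  consider "i = 0" | j where "i = 2 * j + 1" | j where "i = 2 * j + 2"
    by (metis Suc_eq_plus1 add_2_eq_Suc' evenE mult_Suc_right not0_implies_Suc oddE mult_0_right)
  thus ?thesis
    unfolding Pair kinds_def by cases (cases x; auto simp: image_iff Bex_def; presburger)+
qed

lemma multisets_of_kinds_eq_\<F>:
  assumes "n \<le> 2 * M"
  shows "{P. set_mset P \<subseteq> kinds M \<and> (\<Sum>p\<in>#P. fst p) = n} = \<F> n"
proof -
  have "fst p \<le> (\<Sum>p\<in>#P. fst p)" if "p \<in># P" for p :: "nat \<times> color" and P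
    using multi_member_split[OF that] by auto
  thus ?thesis
    using assms unfolding \<F>_def two_color_partitions_def subset_iff mem_kinds
    by fastforce
qed

text \<open>
  The coefficient of $X^n$ only involves parts of size at most \<open>n\<close>, so the series is the limit of
  those for the finite sets \<open>kinds M\<close>, which are the inverses of finite products.
\<close>

lemma generating_function_\<F>:
  fixes e :: "'a :: {idom, t2_space}"
  assumes "e \<noteq> 0"
  shows "qpoch (fps_const e * fps_X) (fps_X ^ 2) * (qpoch fps_X (fps_X ^ 2) * qpoch (fps_X ^ 2) (fps_X ^ 2)) *
         Abs_fps (\<lambda>n. \<Sum>P\<in>\<F> n. e ^ red_odd_parts P) = 1"
    (is "?Q * ?\<Phi> = 1")
proof (rule LIMSEQ_unique)
  define c where "c p = (if snd p = Red then e else 1)" for p :: "nat \<times> color"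
  define Q where "Q M = (\<Prod>p\<in>kinds M. 1 - fps_const (c p) * fps_X ^ fst p)" for M
  define G where "G M = Abs_fps (\<lambda>n. \<Sum>P | set_mset P \<subseteq> kinds M \<and> (\<Sum>p\<in>#P. fst p) = n. \<Prod>p\<in>#P. c p)" for M
  have Q: "Q M = (\<Prod>j<M. 1 - (fps_const e * fps_X) * (fps_X ^ 2) ^ j) *
     ((\<Prod>j<M. 1 - fps_X * (fps_X ^ 2) ^ j) * (\<Prod>j<M. 1 - fps_X ^ 2 * (fps_X ^ 2) ^ j))" for M
  proof -
    have "(2 * i + 1, x) \<noteq> (2 * j + 2, y)" for i j :: nat and x y :: color
      by (auto; presburger)
    hence "(\<lambda>j. (2 * j + 1, Blue)) ` {..<M} \<inter> (\<lambda>j. (2 * j + 2, Blue)) ` {..<M} = {}"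
      by blast
    moreover have "(\<lambda>j. (2 * j + 1, Red)) ` {..<M} \<inter>
       ((\<lambda>j. (2 * j + 1, Blue)) ` {..<M} \<union> (\<lambda>j. (2 * j + 2, Blue)) ` {..<M}) = {}"
      by auto
    ultimately show ?thesis
      unfolding Q_def kinds_def power_mult [symmetric]
      by (simp add: prod.union_disjoint prod.reindex inj_on_def c_def mult_ac power2_eq_square)
  qed
  have "Q \<longlonglongrightarrow> ?Q"
    unfolding Q using assms by (intro tendsto_mult_fps tendsto_qpoch_fps) auto
  moreover have "G \<longlonglongrightarrow> ?\<Phi>"
  proof (rule tendsto_fpsI)
    fix n
    have weight: "(\<Prod>p\<in>#P. c p) = e ^ red_odd_parts P" if "P \<in> \<F> n" for P
    proof -
      have "\<forall>p\<in>#P. even (fst p) \<longrightarrow> snd p = Blue"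
        using that by (simp add: \<F>_def)
      thus ?thesis
        by (induction P) (auto simp: c_def red_odd_parts_def)
    qed
    have "\<forall>\<^sub>F M in sequentially. n \<le> M"
      by (rule eventually_ge_at_top)
    thus "\<forall>\<^sub>F M in sequentially. fps_nth (G M) n = fps_nth ?\<Phi> n"
    proof eventually_elim
      case (elim M)
      thus ?case
        by (simp add: G_def multisets_of_kinds_eq_\<F> weight)
    qed
  qed
  ultimately show "(\<lambda>M. Q M * G M) \<longlonglongrightarrow> ?Q * ?\<Phi>"
    by (rule tendsto_mult_fps)
  have "Q M * G M = 1" for M
    unfolding Q_def G_def
    by (rule multiset_generating_function) (auto simp: mem_kinds, simp add: kinds_def)
  thus "(\<lambda>M. Q M * G M) \<longlonglongrightarrow> 1" by simp
qed

lemma two_times_F1: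
  "2 * of_nat (F1 n) = (\<Sum>P\<in>\<F> n. 1 ^ red_odd_parts P) - (\<Sum>P\<in>\<F> n. (- 1 :: 'a :: comm_ring_1) ^ red_odd_parts P)"
proof -
  have "(\<Sum>P\<in>\<F> n. 1 ^ red_odd_parts P) - (\<Sum>P\<in>\<F> n. (- 1 :: 'a) ^ red_odd_parts P) =
     (\<Sum>P\<in>\<F> n. if odd (red_odd_parts P) then 2 else 0)"
    unfolding sum_subtractf [symmetric] by (intro sum.cong refl) auto
  also have "\<dots> = (\<Sum>P | P \<in> \<F> n \<and> odd (red_odd_parts P). 2)"
    by (rule sum.inter_filter [OF finite_\<F>, symmetric])
  also have "\<dots> = 2 * of_nat (F1 n)"
    by (simp add: F1_def red_odd_parts_def mult.commute)
  finally show ?thesis by simp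
qed

theorem theorem2:
  "(Abs_fps (\<lambda>n. of_nat (F1 n)) :: complex fps) =
     fps_X * (qpochs [fps_X ^ 16, - (fps_X ^ 2), - (fps_X ^ 14)] (fps_X ^ 16) /
              (qpoch fps_X (fps_X ^ 2) * qpoch (fps_X ^ 2) (fps_X ^ 2) ^ 2))"
proof -
  define X where "X = (fps_X :: complex fps)"
  define P where "P = qpoch X (X ^ 2)"
  define M where "M = qpoch (- X) (X ^ 2)"
  define E where "E = qpoch (X ^ 2) (X ^ 2)"
  define T where "T = qpochs [X ^ 16, - (X ^ 2), - (X ^ 14)] (X ^ 16)"
  define \<Phi> where "\<Phi> e = Abs_fps (\<lambda>n. \<Sum>P\<in>\<F> n. e ^ red_odd_parts P)" for e :: complex
  have [simp]: "X \<noteq> 0" "fps_nth X 0 = 0" by (simp_all add: X_def)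
  have nz: "P \<noteq> 0" "E \<noteq> 0"
    unfolding P_def E_def by (intro qpoch_fps_nonzero; simp)+
  have const_coeff: "fps_nth P 0 \<noteq> 0" "fps_nth M 0 \<noteq> 0" "fps_nth E 0 \<noteq> 0"
    unfolding P_def M_def E_def by (subst qpoch_fps_nth_0; simp)+
  have G1: "P * (P * E) * \<Phi> 1 = 1"
    using generating_function_\<F>[of "1 :: complex"] by (simp add: P_def E_def \<Phi>_def X_def)
  have G2: "M * (P * E) * \<Phi> (- 1) = 1"
    using generating_function_\<F>[of "- 1 :: complex"]
    by (simp add: P_def M_def E_def \<Phi>_def X_def fps_const_neg [symmetric] del: fps_const_neg)
  have theta: "E / P - E / M = 2 * X * T"
    using odd_part_of_gauss_series[where 'a = complex] by (simp add: P_def M_def E_def T_def X_def)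
  define F where "F = (Abs_fps (\<lambda>n. of_nat (F1 n)) :: complex fps)"
  have F: "2 * F = \<Phi> 1 - \<Phi> (- 1)"
  proof (rule fps_ext)
    fix n
    have "fps_nth (2 * F) n = 2 * of_nat (F1 n)"
      by (simp only: mult_2 fps_add_nth F_def fps_nth_Abs_fps)
    also have "\<dots> = fps_nth (\<Phi> 1 - \<Phi> (- 1)) n"
      unfolding two_times_F1 by (simp add: \<Phi>_def)
    finally show "fps_nth (2 * F) n = fps_nth (\<Phi> 1 - \<Phi> (- 1)) n" .
  qed
  (* Clearing the denominator P * E^2 turns the two generating functions into Gauss's series. *)
  have "\<Phi> 1 * (P * E ^ 2) = (P * (P * E) * \<Phi> 1) * (E / P)"
    using fps_divide_times_unit[OF const_coeff(1), of E] by (simp add: power2_eq_square mult_ac)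
  hence 1: "\<Phi> 1 * (P * E ^ 2) = E / P"
    by (simp only: G1 mult_1_left)
  have "\<Phi> (- 1) * (P * E ^ 2) = \<Phi> (- 1) * (P * E) * (E / M * M)"
    unfolding fps_divide_times_unit[OF const_coeff(2)] by (simp only: power2_eq_square mult_ac)
  also have "\<dots> = (M * (P * E) * \<Phi> (- 1)) * (E / M)"
    by (simp only: mult_ac)
  finally have 2: "\<Phi> (- 1) * (P * E ^ 2) = E / M"
    by (simp only: G2 mult_1_left)
  have "2 * (F * (P * E ^ 2)) = 2 * (X * T)"
    unfolding mult.assoc [symmetric] F theta [symmetric] left_diff_distrib
    using 1 2 by (simp only: mult.assoc)
  hence "F * (P * E ^ 2) = X * T"
    by simp
  also have "\<dots> = X * (T / (P * E ^ 2)) * (P * E ^ 2)"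
    using const_coeff by (simp add: fps_divide_times_unit mult.assoc)
  finally have "F = X * (T / (P * E ^ 2))"
    using nz by simp
  thus ?thesis
    by (simp only: F_def X_def T_def P_def E_def)
qed

end
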